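(* Let $(\lambda_1,\lambda_2,\lambda_3)$ be a composition of $n$ and let $d=\gcd(\lambda_1+\lambda_2,\lambda_2+\lambda_3)$. For every $x\in\llbracket 1,n\rrbracket$, the orbit of $x$ under the symmetric discrete interval exchange $T_{(\lambda_1,\lambda_2,\lambda_3)}$ is the set $$\left\{x+kd \;\middle|\; k\in\mathbb{Z},\ \frac{1-x}{d}\le k\le\frac{n-x}{d}\right\}.$$
   Context: For $\llbracket a,b\rrbracket=[a,b]\cap\mathbb{Z}$ and a composition $(\lambda_1,\lambda_2,\lambda_3)$ of $n$ (positive integers with sum $n$), $T_{(\lambda_1,\lambda_2,\lambda_3)}$ is the permutation of $\llbracket 1,n\rrbracket$ given by $T(x)=x+\lambda_2+\lambda_3$ for $x\in\llbracket 1,\lambda_1\rrbracket$, $T(x)=x+\lambda_3-\lambda_1$ for $x\in\llbracket \lambda_1+1,\lambda_1+\lambda_2\rrbracket$, and $T(x)=x-\lambda_1-\lambda_2$ for $x\in\llbracket \lambda_1+\lambda_2+1,n\rrbracket$. *)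

theory Defs
  imports Complex_Main "HOL-Combinatorics.Orbits"
begin

text \<open>
  The symmetric discrete interval exchange on \<open>{1..l1 + l2 + l3}\<close>, extended by the identity to all
  integers (the library convention for permutations of a subset of a type).
\<close>

definition sdie :: "int \<Rightarrow> int \<Rightarrow> int \<Rightarrow> int \<Rightarrow> int" where
  "sdie l1 l2 l3 x =
    (if x \<in> {1..l1} then x + l2 + l3
     else if x \<in> {l1 + 1..l1 + l2} then x + l3 - l1
     else if x \<in> {l1 + l2 + 1..l1 + l2 + l3} then x - l1 - l2
     else x)"

lemma sdie_permutes:
  assumes "0 < l1" "0 < l2" "0 < l3"
  shows "sdie l1 l2 l3 permutes {1..l1 + l2 + l3}"
proof (rule bij_imp_permutes)
  have inj: "inj_on (sdie l1 l2 l3) {1..l1 + l2 + l3}"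
    using assms by (auto simp: inj_on_def sdie_def split: if_splits)
  have "sdie l1 l2 l3 ` {1..l1 + l2 + l3} \<subseteq> {1..l1 + l2 + l3}"
    using assms by (auto simp: sdie_def)
  then have "sdie l1 l2 l3 ` {1..l1 + l2 + l3} = {1..l1 + l2 + l3}"
    using inj by (intro endo_inj_surj) auto
  with inj show "bij_betw (sdie l1 l2 l3) {1..l1 + l2 + l3} {1..l1 + l2 + l3}"
    by (simp add: bij_betw_def)
next
  fix x assume "x \<notin> {1..l1 + l2 + l3}"
  then show "sdie l1 l2 l3 x = x"
    using assms by (auto simp: sdie_def)
qed

text \<open>
  The library's \<open>orbit f x\<close> collects the iterates with positive exponent only; since the map is a
  permutation with finite support, this is the full orbit.
\<close>

lemma orbit_sdie:
  assumes "0 < l1" "0 < l2" "0 < l3"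
  shows "orbit (sdie l1 l2 l3) x = {(sdie l1 l2 l3 ^^ m) x | m. True}"
proof (rule orbit_altdef_permutation)
  show "permutation (sdie l1 l2 l3)"
    using sdie_permutes[OF assms] by (rule permutes_imp_permutation[rotated]) simp
qed

end

theory Submission
  imports Defs
begin

text \<open>
  Put \<open>a = l1 + l2\<close> and \<open>b = l2 + l3\<close>. The interval exchange is the first return map to \<open>{1..n}\<close> of
  the rotation \<open>y \<mapsto> y + b\<close> modulo \<open>a + b = n + l2\<close>: on the middle interval the rotation leaves
  \<open>{1..n}\<close> for exactly one step. Hence two points of \<open>{1..n}\<close> share an orbit of the exchange as soon
  as they share an orbit of the rotation, and the orbits of the rotation are the residue classes
  modulo \<open>gcd b (a + b) = gcd a b\<close>.
\<close>

lemma dvd_imp_eq_int: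
  fixes x y N :: int
  assumes "N dvd y - x" and "\<bar>y - x\<bar> < N"
  shows "y = x"
  using assms dvd_imp_le_int[of "y - x" N] by auto

text \<open>Strong induction on the number \<open>k\<close> of rotation steps, with \<open>x\<close>
  arbitrary: one application of the exchange uses up one step on the outer intervals and two on the
  middle one, and the hypothesis is applied at the image of \<open>x\<close>.\<close>

lemma orbit_rotation_subset_orbit_sdie:
  fixes l1 l2 l3 x y :: int and k :: nat
  assumes pos: "0 < l1" "0 < l2" "0 < l3"
    and "x \<in> {1..l1 + l2 + l3}" and "y \<in> {1..l1 + l2 + l3}"
    and "l1 + 2 * l2 + l3 dvd y - (x + int k * (l2 + l3))"
  shows "y \<in> orbit (sdie l1 l2 l3) x"
  using assms(4-)
proof (induction k arbitrary: x rule: less_induct)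
  case (less k)
  let ?T = "sdie l1 l2 l3" and ?N = "l1 + 2 * l2 + l3"
  have step: "y \<in> orbit ?T x" if "y \<in> orbit ?T (?T x)"
    using that orbit_trans orbit.base by metis
  have Tx: "?T x \<in> {1..l1 + l2 + l3}"
    using sdie_permutes[OF pos] less.prems(1) by (simp only: permutes_in_image)
  show ?case
  proof (cases k)
    case 0
    then have "y = x"
      using less.prems pos by (intro dvd_imp_eq_int[of ?N]) auto
    then show ?thesis
      \<comment> \<open>\<open>orbit\<close> collects positive iterates only, so that
        \<open>x\<close> lies in its own orbit relies on the map being a permutation of finite
        support.\<close>
      using orbit_sdie[OF pos, of x] by (auto intro: exI[of _ 0])
  next
    case (Suc j)
    consider "x \<le> l1" | "l1 < x" "x \<le> l1 + l2" | "l1 + l2 < x"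
      by linarith
    then show ?thesis
    proof cases
      case 1
      then have "y - (?T x + int j * (l2 + l3)) = y - (x + int k * (l2 + l3))"
        using less.prems(1) Suc by (simp add: sdie_def algebra_simps)
      then have "?N dvd y - (?T x + int j * (l2 + l3))"
        using less.prems(3) by (simp only:)
      then show ?thesis
        using less.IH[of j "?T x"] less.prems Tx Suc step by simp
    next
      case 2
      then have T: "?T x = x + l3 - l1"
        by (simp add: sdie_def)
      show ?thesis
      proof (cases j)
        case 0
        \<comment> \<open>Exactly one rotation step is left, and it lands in the gap between
          \<open>l1 + l2 + l3\<close> and \<open>?N\<close>, which contains no admissible
          \<open>y\<close>: this case is contradictory.\<close>
        then have "y = x + (l2 + l3)"
          using less.prems 2 Suc pos by (intro dvd_imp_eq_int[of ?N]) auto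
        then show ?thesis
          using less.prems(2) 2 by simp
      next
        case (Suc i)
        \<comment> \<open>The displacement is \<open>l3 - l1 = 2 * (l2 + l3) - ?N\<close>, that is,
          two rotation steps with one wrap-around.\<close>
        have "y - (?T x + int i * (l2 + l3)) = (y - (x + int k * (l2 + l3))) + ?N"
          using T Suc \<open>k = Suc j\<close> by (simp add: algebra_simps)
        then have "?N dvd y - (?T x + int i * (l2 + l3))"
          using less.prems(3) by (simp only: dvd_add_triv_right_iff)
        then show ?thesis
          using less.IH[of i "?T x"] less.prems Tx Suc \<open>k = Suc j\<close> step by simp
      qed
    next
      case 3
      \<comment> \<open>Here \<open>- l1 - l2 = (l2 + l3) - ?N\<close>: a single step that wraps
        around.\<close>
      then have "y - (?T x + int j * (l2 + l3)) = (y - (x + int k * (l2 + l3))) + ?N"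
        using less.prems(1) pos Suc by (simp add: sdie_def algebra_simps)
      then have "?N dvd y - (?T x + int j * (l2 + l3))"
        using less.prems(3) by (simp only: dvd_add_triv_right_iff)
      then show ?thesis
        using less.IH[of j "?T x"] less.prems Tx Suc step by simp
    qed
  qed
qed

text \<open>Bezout gives an integer multiplier, possibly negative. Reducing it modulo
  \<open>N\<close> makes it a natural number, as needed for counting forward rotation steps.\<close>

lemma gcd_dvd_imp_ex_nat_multiple:
  fixes b c N :: int
  assumes "0 < N" and "gcd b N dvd c"
  shows "\<exists>k :: nat. N dvd c - int k * b"
proof -
  obtain j where j: "c = gcd b N * j"
    using assms(2) by (elim dvdE)
  obtain u v where uv: "u * b + v * N = gcd b N"
    using bezout_int by blast
  define q k where "q = (j * u) div N" and "k = nat ((j * u) mod N)"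
  have "int k = j * u - N * q"
    using assms(1) by (simp add: q_def k_def minus_mult_div_eq_mod)
  then have "c - int k * b = N * (v * j + q * b)"
    by (simp only: j uv[symmetric]) (simp add: algebra_simps)
  then show ?thesis
    by (metis dvd_triv_left)
qed

text \<open>With \<open>a = l1 + l2\<close> and \<open>b = l2 + l3\<close>, the displacements on the
  three intervals are \<open>b\<close>, \<open>b - a\<close> and \<open>- a\<close>. Hence the
  residue modulo the gcd is constant along orbits.\<close>

lemma gcd_dvd_sdie_diff:
  "gcd (l1 + l2) (l2 + l3) dvd sdie l1 l2 l3 x - x"
proof -
  let ?d = "gcd (l1 + l2) (l2 + l3)"
  have "?d dvd l3 - l1"
    using dvd_diff[of ?d "l2 + l3" "l1 + l2"] by simp
  moreover have "?d dvd - l1 - l2"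
    using dvd_minus_iff[of ?d "l1 + l2"] by (simp only: gcd_dvd1 minus_add_distrib add_uminus_conv_diff)
  ultimately show ?thesis
    by (auto simp: sdie_def)
qed

lemma orbit_sdie_eq:
  fixes l1 l2 l3 x :: int
  assumes pos: "0 < l1" "0 < l2" "0 < l3" and x: "x \<in> {1..l1 + l2 + l3}"
  shows "orbit (sdie l1 l2 l3) x =
    {y \<in> {1..l1 + l2 + l3}. gcd (l1 + l2) (l2 + l3) dvd y - x}"
    (is "?O = {y \<in> ?I. ?d dvd y - x}")
proof (intro equalityI subsetI)
  fix y assume "y \<in> ?O"
  then show "y \<in> {y \<in> ?I. ?d dvd y - x}"
  proof induction
    case base
    then show ?case
      using x permutes_in_image[OF sdie_permutes[OF pos], of x] gcd_dvd_sdie_diff by blast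
  next
    case (step y)
    have "?d dvd (sdie l1 l2 l3 y - y) + (y - x)"
      using step gcd_dvd_sdie_diff by (intro dvd_add) blast+
    then show ?case
      using step permutes_in_image[OF sdie_permutes[OF pos], of y] by simp
  qed
next
  fix y assume y: "y \<in> {y \<in> ?I. ?d dvd y - x}"
  have "gcd (l2 + l3) (l1 + 2 * l2 + l3) = ?d"
    using gcd_add2[of "l2 + l3" "l1 + l2"] by (simp add: algebra_simps gcd.commute)
  then obtain k :: nat where "l1 + 2 * l2 + l3 dvd (y - x) - int k * (l2 + l3)"
    using gcd_dvd_imp_ex_nat_multiple[of "l1 + 2 * l2 + l3" "l2 + l3" "y - x"] pos y by auto
  then show "y \<in> ?O"
    using orbit_rotation_subset_orbit_sdie[OF pos x, of y k] y by (simp add: diff_diff_eq)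
qed

theorem theorem14:
  fixes l1 l2 l3 n d x :: int
  assumes "0 < l1" and "0 < l2" and "0 < l3" and "l1 + l2 + l3 = n"
    and "d = gcd (l1 + l2) (l2 + l3)"
    and "x \<in> {1..n}"
  shows "orbit (sdie l1 l2 l3) x =
    {x + k * d | k :: int.
      real_of_int (1 - x) / real_of_int d \<le> real_of_int k \<and>
      real_of_int k \<le> real_of_int (n - x) / real_of_int d}"
proof -
  have d: "0 < d"
    using assms by (simp add: gcd_pos_int)
  \<comment> \<open>Multiplying by the positive \<open>d\<close> turns the real bounds on
    \<open>k\<close> into the condition that \<open>x + k * d\<close> stays in the domain.\<close>
  have bounds: "real_of_int (1 - x) / real_of_int d \<le> real_of_int k \<and>
      real_of_int k \<le> real_of_int (n - x) / real_of_int d \<longleftrightarrow> x + k * d \<in> {1..n}" for k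
  proof -
    have "real_of_int (1 - x) / real_of_int d \<le> real_of_int k \<longleftrightarrow> 1 - x \<le> k * d"
      using d by (simp only: pos_divide_le_eq of_int_0_less_iff flip: of_int_mult) (simp only: of_int_le_iff)
    moreover have "real_of_int k \<le> real_of_int (n - x) / real_of_int d \<longleftrightarrow> k * d \<le> n - x"
      using d by (simp only: pos_le_divide_eq of_int_0_less_iff flip: of_int_mult) (simp only: of_int_le_iff)
    ultimately show ?thesis
      by auto
  qed
  have "orbit (sdie l1 l2 l3) x = {y \<in> {1..n}. d dvd y - x}"
    using orbit_sdie_eq[of l1 l2 l3 x] assms by simp
  also have "\<dots> = {x + k * d | k. x + k * d \<in> {1..n}}"
  proof (intro equalityI subsetI)
    fix y assume y: "y \<in> {y \<in> {1..n}. d dvd y - x}"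
    then obtain k where "y - x = d * k"
      by blast
    then have "y = x + k * d"
      by (simp add: algebra_simps)
    then show "y \<in> {x + k * d | k. x + k * d \<in> {1..n}}"
      using y by blast
  qed auto
  finally show ?thesis
    by (simp only: bounds)
qed

end
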